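(* Let $S$ be a set of states, $I\subseteq S$ a set of initial states, $T\subseteq S\times S$ a transition relation that is total (for every $s\in S$ there is $s'\in S$ with $(s,s')\in T$), and $P\subseteq S$ a property. Define $\Phi\colon 2^S\to 2^S$, $\Phi(X)=I\cup\mathrm{Succs}(X)$ with $\mathrm{Succs}(X)=\{t'\mid\exists t\in X\colon (t,t')\in T\}$, and $\Psi_P\colon 2^S\to 2^S$, $\Psi_P(X)=\Phi(X)\cap P$. Then for every natural number $k\ge 1$: $\Phi(\Psi_P^{k-1}(P))\subseteq P$ if and only if both of the following formulae are valid: (init) $I(s_1)\wedge T(s_1,s_2)\wedge\dots\wedge T(s_{k-1},s_k)\implies P(s_1)\wedge\dots\wedge P(s_k)$; (step) $P(s_1)\wedge T(s_1,s_2)\wedge P(s_2)\wedge\dots\wedge T(s_{k-1},s_k)\wedge P(s_k)\wedge T(s_k,s_{k+1})\implies P(s_{k+1})$.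
   Context: $\Psi_P^{j}$ denotes $j$-fold iteration of $\Psi_P$ ($\Psi_P^0(P)=P$). In the formulae, $s_1,\dots,s_{k+1}$ are variables ranging over states, and $I(s)$, $T(s,s')$, $P(s)$ are relation symbols interpreted as $I$, $T$, $P$ respectively (so an interpretation $\mu$ assigning states to variables satisfies $I(s)$ iff $\mu(s)\in I$, $T(s,s')$ iff $(\mu(s),\mu(s'))\in T$, $P(s)$ iff $\mu(s)\in P$). A formula is valid if it is satisfied by every such interpretation. The lattice is $(2^S,\subseteq)$. *)

theory Defs
  imports Main
begin

definition Succs :: "('s \<times> 's) set \<Rightarrow> 's set \<Rightarrow> 's set" where
  "Succs T X = {t'. \<exists>t\<in>X. (t, t') \<in> T}"

definition Phi :: "'s set \<Rightarrow> ('s \<times> 's) set \<Rightarrow> 's set \<Rightarrow> 's set" where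
  "Phi I T X = I \<union> Succs T X"

definition Psi :: "'s set \<Rightarrow> ('s \<times> 's) set \<Rightarrow> 's set \<Rightarrow> 's set \<Rightarrow> 's set" where
  "Psi I T P X = Phi I T X \<inter> P"

text \<open>The natural number \<open>i\<close> serves as the variable \<open>s\<^sub>i\<close>.\<close>

datatype formula =
    InitAtom nat
  | TransAtom nat nat
  | PropAtom nat
  | Conj "formula list"
  | Implies formula formula

fun satisfies ::
  "'s set \<Rightarrow> ('s \<times> 's) set \<Rightarrow> 's set \<Rightarrow> (nat \<Rightarrow> 's) \<Rightarrow> formula \<Rightarrow> bool" where
  "satisfies I T P \<mu> (InitAtom i) \<longleftrightarrow> \<mu> i \<in> I"
| "satisfies I T P \<mu> (TransAtom i j) \<longleftrightarrow> (\<mu> i, \<mu> j) \<in> T"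
| "satisfies I T P \<mu> (PropAtom i) \<longleftrightarrow> \<mu> i \<in> P"
| "satisfies I T P \<mu> (Conj fs) \<longleftrightarrow> (\<forall>f\<in>set fs. satisfies I T P \<mu> f)"
| "satisfies I T P \<mu> (Implies f g) \<longleftrightarrow> (satisfies I T P \<mu> f \<longrightarrow> satisfies I T P \<mu> g)"

text \<open>Only interpretations whose values lie in the state set \<open>S\<close> count, as \<open>S\<close> need not
  exhaust the type of states.\<close>

definition valid ::
  "'s set \<Rightarrow> 's set \<Rightarrow> ('s \<times> 's) set \<Rightarrow> 's set \<Rightarrow> formula \<Rightarrow> bool" where
  "valid S I T P f \<longleftrightarrow> (\<forall>\<mu>. (\<forall>i. \<mu> i \<in> S) \<longrightarrow> satisfies I T P \<mu> f)"

text \<open>\<open>I(s\<^sub>1) \<and> T(s\<^sub>1,s\<^sub>2) \<and> \<dots> \<and> T(s\<^bsub>k-1\<^esub>,s\<^sub>k) \<Longrightarrow> P(s\<^sub>1) \<and> \<dots> \<and> P(s\<^sub>k)\<close>;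
  the interval \<open>[m..<n]\<close> excludes \<open>n\<close>, so for \<open>k = 1\<close> there is no transition atom.\<close>

definition init_formula :: "nat \<Rightarrow> formula" where
  "init_formula k =
     Implies
       (Conj (InitAtom 1 # map (\<lambda>i. TransAtom i (i + 1)) [1..<k]))
       (Conj (map PropAtom [1..<k + 1]))"

text \<open>\<open>P(s\<^sub>1) \<and> T(s\<^sub>1,s\<^sub>2) \<and> P(s\<^sub>2) \<and> \<dots> \<and> P(s\<^sub>k) \<and> T(s\<^sub>k,s\<^bsub>k+1\<^esub>) \<Longrightarrow> P(s\<^bsub>k+1\<^esub>)\<close>\<close>

definition step_formula :: "nat \<Rightarrow> formula" where
  "step_formula k =
     Implies
       (Conj (concat (map (\<lambda>i. [PropAtom i, TransAtom i (i + 1)]) [1..<k + 1])))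
       (PropAtom (k + 1))"

end

(* With G X = Succs T X \<inter> P, distributivity of Succs over unions gives
     Psi^n P = G^n P \<union> (\<Union>m<n. G^m (I \<inter> P)).
   The set G^n X consists of the endpoints of n-step paths that start in X and stay in P
   afterwards. So the successors of the first part lie in P iff the step formula with k = n + 1
   is valid. The successors of the remaining parts, together with I, lie in P iff every initial
   path with at most k states stays in P. As T is total, shorter initial paths extend to paths
   with exactly k states, so this is the validity of the init formula. *)

theory Submission
  imports Defs
begin

definition succs_in :: "('s \<times> 's) set \<Rightarrow> 's set \<Rightarrow> 's set \<Rightarrow> 's set" where
  "succs_in T P X = Succs T X \<inter> P"

text \<open>The content of the init formula, with paths as functions indexed from 1 like the
  variables: the premise constrains only the indices 1 to \<open>k\<close>, and all other values are
  free.\<close>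

definition stays_in_init :: "'s set \<Rightarrow> ('s \<times> 's) set \<Rightarrow> 's set \<Rightarrow> nat \<Rightarrow> bool" where
  "stays_in_init I T P k \<longleftrightarrow>
    (\<forall>\<mu>. \<mu> 1 \<in> I \<longrightarrow> (\<forall>i\<in>{1..<k}. (\<mu> i, \<mu> (Suc i)) \<in> T) \<longrightarrow> (\<forall>i\<in>{1..k}. \<mu> i \<in> P))"

lemma Succs_Un: "Succs T (X \<union> Y) = Succs T X \<union> Succs T Y"
  by (auto simp: Succs_def)

lemma Succs_UN: "Succs T (\<Union>m\<in>M. X m) = (\<Union>m\<in>M. Succs T (X m))"
  by (auto simp: Succs_def)

lemma Psi_Un_UN:
  "Psi I T P (Y \<union> (\<Union>m\<in>M. X m)) = (I \<inter> P) \<union> succs_in T P Y \<union> (\<Union>m\<in>M. succs_in T P (X m))"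
  unfolding Psi_def Phi_def succs_in_def Succs_Un Succs_UN by blast

lemma Psi_funpow:
  "(Psi I T P ^^ n) P = (succs_in T P ^^ n) P \<union> (\<Union>m<n. (succs_in T P ^^ m) (I \<inter> P))"
proof (induction n)
  case 0
  show ?case by simp
next
  case (Suc n)
  have "(Psi I T P ^^ Suc n) P = (I \<inter> P) \<union> (succs_in T P ^^ Suc n) P
      \<union> (\<Union>m<n. (succs_in T P ^^ Suc m) (I \<inter> P))"
    by (simp add: Suc.IH Psi_Un_UN)
  \<comment> \<open>\<open>I \<inter> P\<close> becomes the summand for \<open>m = 0\<close>; the
    other summands are the old ones shifted by one.\<close>
  also have "\<dots> = (succs_in T P ^^ Suc n) P \<union> (\<Union>m<Suc n. (succs_in T P ^^ m) (I \<inter> P))"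
    by (simp add: lessThan_Suc_eq_insert_0 Un_ac)
  finally show ?case .
qed

text \<open>Since \<open>Succs\<close> distributes over the union in \<open>Psi_funpow\<close>, each
  piece can be tested separately. The first two conjuncts will match the init formula, the third the
  step formula.\<close>

lemma Phi_Psi_subset_iff:
  "Phi I T ((Psi I T P ^^ n) P) \<subseteq> P \<longleftrightarrow>
    I \<subseteq> P \<and> (\<forall>m<n. Succs T ((succs_in T P ^^ m) (I \<inter> P)) \<subseteq> P)
      \<and> Succs T ((succs_in T P ^^ n) P) \<subseteq> P"
  unfolding Psi_funpow Phi_def Succs_Un Succs_UN by blast

text \<open>Each application of \<open>succs_in\<close> appends one state in \<open>P\<close>. The
  start at index 1 is only constrained by \<open>X\<close>, and \<open>n\<close> steps end at index
  \<open>n + 1\<close>.\<close>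

lemma mem_succs_in_funpow_iff:
  "t \<in> (succs_in T P ^^ n) X \<longleftrightarrow>
    (\<exists>\<mu>. \<mu> 1 \<in> X \<and> (\<forall>i\<in>{1..n}. (\<mu> i, \<mu> (Suc i)) \<in> T \<and> \<mu> (Suc i) \<in> P) \<and> \<mu> (Suc n) = t)"
proof (induction n arbitrary: t)
  case 0
  show ?case by auto
next
  case (Suc n)
  show ?case
  proof
    assume "t \<in> (succs_in T P ^^ Suc n) X"
    then obtain s where s: "s \<in> (succs_in T P ^^ n) X" "(s, t) \<in> T" "t \<in> P"
      by (auto simp: succs_in_def Succs_def)
    then obtain \<mu> where \<mu>: "\<mu> 1 \<in> X" "\<mu> (Suc n) = s"
      "\<forall>i\<in>{1..n}. (\<mu> i, \<mu> (Suc i)) \<in> T \<and> \<mu> (Suc i) \<in> P"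
      using Suc.IH by blast
    \<comment> \<open>The path to \<open>s\<close> uses only indices up to \<open>n + 1\<close>, so
      overwriting the next one leaves it intact.\<close>
    let ?\<nu> = "\<mu>(Suc (Suc n) := t)"
    have "?\<nu> 1 \<in> X \<and> (\<forall>i\<in>{1..Suc n}. (?\<nu> i, ?\<nu> (Suc i)) \<in> T \<and> ?\<nu> (Suc i) \<in> P)
        \<and> ?\<nu> (Suc (Suc n)) = t"
      using \<mu> s by (auto simp: atLeastAtMostSuc_conv)
    then show "\<exists>\<mu>. \<mu> 1 \<in> X \<and> (\<forall>i\<in>{1..Suc n}. (\<mu> i, \<mu> (Suc i)) \<in> T \<and> \<mu> (Suc i) \<in> P)
        \<and> \<mu> (Suc (Suc n)) = t"
      by blast
  next
    assume "\<exists>\<mu>. \<mu> 1 \<in> X \<and> (\<forall>i\<in>{1..Suc n}. (\<mu> i, \<mu> (Suc i)) \<in> T \<and> \<mu> (Suc i) \<in> P)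
        \<and> \<mu> (Suc (Suc n)) = t"
    then obtain \<mu> where \<mu>: "\<mu> 1 \<in> X" "\<mu> (Suc (Suc n)) = t"
      "\<forall>i\<in>{1..Suc n}. (\<mu> i, \<mu> (Suc i)) \<in> T \<and> \<mu> (Suc i) \<in> P"
      by blast
    then have "\<mu> (Suc n) \<in> (succs_in T P ^^ n) X"
      using Suc.IH by auto
    moreover have "(\<mu> (Suc n), t) \<in> T" "t \<in> P"
      using \<mu> by auto
    ultimately show "t \<in> (succs_in T P ^^ Suc n) X"
      by (auto simp: succs_in_def Succs_def)
  qed
qed

text \<open>Intersecting with \<open>P\<close> covers the first state, which \<open>succs_in\<close>
  does not check. The set \<open>X\<close> is arbitrary so that \<open>X = I\<close> serves the init
  formula and \<open>X = UNIV\<close> the step formula.\<close>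

lemma Succs_succs_in_subset_iff:
  "Succs T ((succs_in T P ^^ n) (X \<inter> P)) \<subseteq> P \<longleftrightarrow>
    (\<forall>\<mu>. \<mu> 1 \<in> X \<longrightarrow> (\<forall>i\<in>{1..Suc n}. \<mu> i \<in> P \<and> (\<mu> i, \<mu> (Suc i)) \<in> T) \<longrightarrow> \<mu> (Suc (Suc n)) \<in> P)"
    (is "?L \<longleftrightarrow> ?R")
proof
  assume L: ?L
  show ?R
  proof (intro allI impI)
    fix \<mu>
    assume \<mu>: "\<mu> 1 \<in> X" "\<forall>i\<in>{1..Suc n}. \<mu> i \<in> P \<and> (\<mu> i, \<mu> (Suc i)) \<in> T"
    have "\<mu> 1 \<in> X \<inter> P" "\<forall>i\<in>{1..n}. (\<mu> i, \<mu> (Suc i)) \<in> T \<and> \<mu> (Suc i) \<in> P"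
      using \<mu> by auto
    then have "\<mu> (Suc n) \<in> (succs_in T P ^^ n) (X \<inter> P)"
      unfolding mem_succs_in_funpow_iff by blast
    moreover have "(\<mu> (Suc n), \<mu> (Suc (Suc n))) \<in> T"
      using \<mu> by auto
    ultimately show "\<mu> (Suc (Suc n)) \<in> P"
      using L by (auto simp: Succs_def)
  qed
next
  assume R: ?R
  show ?L
  proof
    fix t
    assume "t \<in> Succs T ((succs_in T P ^^ n) (X \<inter> P))"
    then obtain \<mu> where \<mu>: "\<mu> 1 \<in> X \<inter> P" "(\<mu> (Suc n), t) \<in> T"
      "\<forall>i\<in>{1..n}. (\<mu> i, \<mu> (Suc i)) \<in> T \<and> \<mu> (Suc i) \<in> P"
      by (auto simp: Succs_def mem_succs_in_funpow_iff)
    have P: "\<mu> i \<in> P" if "i \<in> {1..Suc n}" for i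
      using \<mu> that by (cases i; cases "i = 1") auto
    let ?\<nu> = "\<mu>(Suc (Suc n) := t)"
    have "?\<nu> 1 \<in> X" "\<forall>i\<in>{1..Suc n}. ?\<nu> i \<in> P \<and> (?\<nu> i, ?\<nu> (Suc i)) \<in> T"
      using \<mu> P by (auto simp: le_Suc_eq)
    then have "?\<nu> (Suc (Suc n)) \<in> P"
      using R by blast
    then show "t \<in> P"
      by simp
  qed
qed

text \<open>From left to right, totality extends a path of \<open>n + 1\<close> states by one more,
  so that the assumption applies. Conversely, the first conjunct puts all states but the last in
  \<open>P\<close>, and the second then covers the last.\<close>

lemma stays_in_init_Suc_iff:
  assumes "I \<subseteq> S" "T \<subseteq> S \<times> S" "\<forall>s\<in>S. \<exists>s'\<in>S. (s, s') \<in> T"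
  shows "stays_in_init I T P (Suc (Suc n)) \<longleftrightarrow>
    stays_in_init I T P (Suc n) \<and> Succs T ((succs_in T P ^^ n) (I \<inter> P)) \<subseteq> P"
proof
  assume A: "stays_in_init I T P (Suc (Suc n))"
  have "stays_in_init I T P (Suc n)"
    unfolding stays_in_init_def
  proof (intro allI impI)
    fix \<mu> :: "nat \<Rightarrow> 'a"
    assume \<mu>: "\<mu> 1 \<in> I" "\<forall>i\<in>{1..<Suc n}. (\<mu> i, \<mu> (Suc i)) \<in> T"
    \<comment> \<open>Totality gives successors for states in \<open>S\<close>: for
      \<open>n = 0\<close> the last state lies in \<open>I\<close>, otherwise it is the target of a
      transition.\<close>
    have "\<mu> (Suc n) \<in> S"
      using \<mu> assms(1,2) by (cases n) auto
    then obtain t where t: "(\<mu> (Suc n), t) \<in> T"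
      using assms(3) by blast
    let ?\<nu> = "\<mu>(Suc (Suc n) := t)"
    have "?\<nu> 1 \<in> I" "\<forall>i\<in>{1..<Suc (Suc n)}. (?\<nu> i, ?\<nu> (Suc i)) \<in> T"
      using \<mu> t by (auto simp: less_Suc_eq)
    then have "\<forall>i\<in>{1..Suc (Suc n)}. ?\<nu> i \<in> P"
      using A unfolding stays_in_init_def by blast
    then show "\<forall>i\<in>{1..Suc n}. \<mu> i \<in> P"
      by (simp add: atLeastAtMostSuc_conv)
  qed
  moreover have "Succs T ((succs_in T P ^^ n) (I \<inter> P)) \<subseteq> P"
    using A unfolding Succs_succs_in_subset_iff stays_in_init_def
    by (simp add: atLeastLessThanSuc_atLeastAtMost)
  ultimately show "stays_in_init I T P (Suc n) \<and> Succs T ((succs_in T P ^^ n) (I \<inter> P)) \<subseteq> P" ..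
next
  assume "stays_in_init I T P (Suc n) \<and> Succs T ((succs_in T P ^^ n) (I \<inter> P)) \<subseteq> P"
  then show "stays_in_init I T P (Suc (Suc n))"
    unfolding Succs_succs_in_subset_iff stays_in_init_def
    by (simp add: atLeastLessThanSuc_atLeastAtMost atLeastAtMostSuc_conv ball_Un)
qed

lemma stays_in_init_iff:
  assumes "I \<subseteq> S" "T \<subseteq> S \<times> S" "\<forall>s\<in>S. \<exists>s'\<in>S. (s, s') \<in> T"
  shows "stays_in_init I T P (Suc n) \<longleftrightarrow>
    I \<subseteq> P \<and> (\<forall>m<n. Succs T ((succs_in T P ^^ m) (I \<inter> P)) \<subseteq> P)"
proof (induction n)
  case 0
  show ?case by (auto simp: stays_in_init_def)
next
  case (Suc n)
  show ?case
    unfolding stays_in_init_Suc_iff[OF assms] Suc.IH by (auto simp: less_Suc_eq)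
qed

text \<open>Only the variables of the formula matter, so an interpretation whose relevant values lie
  in \<open>S\<close> can be made constant elsewhere.\<close>

lemma valid_init_formula_iff:
  assumes "I \<subseteq> S" "T \<subseteq> S \<times> S"
  shows "valid S I T P (init_formula k) \<longleftrightarrow> stays_in_init I T P k"
proof
  assume V: "valid S I T P (init_formula k)"
  show "stays_in_init I T P k"
    unfolding stays_in_init_def
  proof (intro allI impI)
    fix \<mu> :: "nat \<Rightarrow> 'a"
    assume \<mu>: "\<mu> 1 \<in> I" "\<forall>i\<in>{1..<k}. (\<mu> i, \<mu> (Suc i)) \<in> T"
    define \<nu> where "\<nu> i = (if i \<in> {1..k} then \<mu> i else \<mu> 1)" for i
    \<comment> \<open>The first state lies in \<open>I\<close>, every later one is the target of a
      transition.\<close>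
    have "\<mu> i \<in> S" if "i \<in> {1..k}" for i
      using \<mu> assms that by (cases "i = 1"; cases i) fastforce+
    then have "\<forall>i. \<nu> i \<in> S"
      using \<mu>(1) assms(1) by (auto simp: \<nu>_def)
    then have "satisfies I T P \<nu> (init_formula k)"
      using V by (simp add: valid_def)
    then show "\<forall>i\<in>{1..k}. \<mu> i \<in> P"
      using \<mu> by (auto simp: init_formula_def \<nu>_def)
  qed
next
  assume "stays_in_init I T P k"
  then show "valid S I T P (init_formula k)"
    by (auto simp: valid_def init_formula_def stays_in_init_def)
qed

text \<open>Every variable of the step formula occurs in a transition atom of its premise, so
  restricting values to \<open>S\<close> excludes no relevant path.\<close>

lemma valid_step_formula_iff:
  assumes "T \<subseteq> S \<times> S"
  shows "valid S I T P (step_formula (Suc n)) \<longleftrightarrow> Succs T ((succs_in T P ^^ n) P) \<subseteq> P"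
proof -
  have "valid S I T P (step_formula (Suc n)) \<longleftrightarrow>
    (\<forall>\<mu>. (\<forall>i\<in>{1..Suc n}. \<mu> i \<in> P \<and> (\<mu> i, \<mu> (Suc i)) \<in> T) \<longrightarrow> \<mu> (Suc (Suc n)) \<in> P)"
    (is "?V \<longleftrightarrow> ?R")
  proof
    assume V: ?V
    show ?R
    proof (intro allI impI)
      fix \<mu> :: "nat \<Rightarrow> 'a"
      assume \<mu>: "\<forall>i\<in>{1..Suc n}. \<mu> i \<in> P \<and> (\<mu> i, \<mu> (Suc i)) \<in> T"
      define \<nu> where "\<nu> i = (if i \<in> {1..Suc (Suc n)} then \<mu> i else \<mu> 1)" for i
      have "\<mu> i \<in> S" if "i \<in> {1..Suc (Suc n)}" for i
      proof (cases "i = Suc (Suc n)")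
        case True
        then show ?thesis using \<mu> assms by auto
      next
        case False
        then have "(\<mu> i, \<mu> (Suc i)) \<in> T"
          using \<mu> that by auto
        then show ?thesis using assms by auto
      qed
      then have "\<forall>i. \<nu> i \<in> S"
        by (auto simp: \<nu>_def)
      then have "satisfies I T P \<nu> (step_formula (Suc n))"
        using V by (simp add: valid_def)
      then show "\<mu> (Suc (Suc n)) \<in> P"
        using \<mu> by (auto simp: step_formula_def \<nu>_def simp del: upt_Suc)
    qed
  next
    assume R: ?R
    show ?V
      unfolding valid_def
    proof (intro allI impI)
      fix \<mu>
      show "satisfies I T P \<mu> (step_formula (Suc n))"
        using R[rule_format, of \<mu>]
        by (auto simp: step_formula_def less_Suc_eq_le simp del: upt_Suc)
    qed
  qed
  then show ?thesis
    \<comment> \<open>With \<open>X = UNIV\<close> the start condition is void and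
      \<open>X \<inter> P\<close> is \<open>P\<close>.\<close>
    using Succs_succs_in_subset_iff[where X = UNIV and T = T and P = P and n = n] by simp
qed

theorem theorem4:
  fixes S I P :: "'s set" and T :: "('s \<times> 's) set" and k :: nat
  assumes "I \<subseteq> S"
    and "T \<subseteq> S \<times> S"
    and "\<forall>s\<in>S. \<exists>s'\<in>S. (s, s') \<in> T"
    and "P \<subseteq> S"
    and "k \<ge> 1"
  shows "Phi I T ((Psi I T P ^^ (k - 1)) P) \<subseteq> P \<longleftrightarrow>
    valid S I T P (init_formula k) \<and> valid S I T P (step_formula k)"
proof -
  \<comment> \<open>As \<open>k\<close> is positive, \<open>k - 1\<close> is a true predecessor:
    \<open>n\<close> iterations correspond to formulae for \<open>n + 1\<close>.\<close>
  obtain n where k: "k = Suc n"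
    using assms(5) by (cases k) auto
  show ?thesis
    unfolding k valid_init_formula_iff[OF assms(1,2)] stays_in_init_iff[OF assms(1-3)]
      valid_step_formula_iff[OF assms(2)]
    by (simp add: Phi_Psi_subset_iff)
qed

end
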